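(* Let $\beta>0$, let $\Delta t>0$ and $h>0$ be arbitrary, and let $\rho^{k}=(\rho^k_{i,j})$ and $\rho^{k+1}=(\rho^{k+1}_{i,j})$ be $N$-periodic grid functions with values in $I$ such that $\rho^{k+1}$ is obtained from $\rho^k$ by one step of the scheme $$\frac{\rho^{k+1}_{i,j}-\rho^{k}_{i,j}}{\Delta t}+\frac1h\left[F^{k+1}_{i+1/2,j}-F^{k+1}_{i-1/2,j}+F^{k+1}_{i,j+1/2}-F^{k+1}_{i,j-1/2}\right]=0\qquad\text{for all } i,j,$$ with the numerical fluxes $F^{k+1}$ (depending on $\rho^{k+1}$ and $\rho^k$) defined in the context. Then: 1. (Conservation of mass) $\displaystyle\sum_{i,j=0}^{N-1}\rho^{k+1}_{i,j}=\sum_{i,j=0}^{N-1}\rho^{k}_{i,j}$. 2. (Boundedness of the phase-field) If $|\rho^{k}_{i,j}|\le 1$ for all $i,j$, then $|\rho^{k+1}_{i,j}|\le 1$ for all $i,j$.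
   Context: Setting: a finite-volume scheme on a two-dimensional square with periodic boundary conditions, with uniform mesh size $h>0$ and $N\times N$ cells. A grid function is a family of real numbers $\phi=(\phi_{i,j})_{i,j\in\mathbb Z}$ that is $N$-periodic in each index: $\phi_{i,j}=\phi_{i\pm N,j}=\phi_{i,j\pm N}$. Potential: $f=f_c-f_e$, where $f_c,f_e:I\to\mathbb R$ are convex and differentiable on an open interval $I\subseteq\mathbb R$ (for example $I=\mathbb R$ for the Ginzburg--Landau potential $f(\rho)=\frac14(\rho^2-1)^2$, or $I=(-1,1)$ for a logarithmic potential). Discrete convolution: $J=(J_{n,m})$ is an $N$-periodic grid function (discretization of a nonnegative radially symmetric kernel) with $J_{n,m}\ge 0$ and $J_{n,m}=J_{-n,m}=J_{n,-m}=J_{m,n}$, and $$[J\star\phi]_{i,j}:=h^2\sum_{n,m=0}^{N-1}J_{n,m}\,\phi_{i-n,j-m}.$$ Notation: $[a]^+:=\max\{a,0\}$ and $[a]^-:=\min\{a,0\}$, so $a=[a]^++[a]^-$. Discrete mobility: $M(x,y):=\beta[1+x]^+[1-y]^+$ with $\beta>0$. Discrete chemical potential: $w^{k+1}_{i,j}:=f_c'(\rho^{k+1}_{i,j})-f_e'(\rho^{k}_{i,j})+2\rho^{k+1}_{i,j}-2[J\star\rho^k]_{i,j}$. Velocities: $u^{k+1}_{i+1/2,j}:=-\frac1h(w^{k+1}_{i+1,j}-w^{k+1}_{i,j})$ and $u^{k+1}_{i,j+1/2}:=-\frac1h(w^{k+1}_{i,j+1}-w^{k+1}_{i,j})$. Numerical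 fluxes: $$F^{k+1}_{i+1/2,j}:=M(\rho^{k+1}_{i,j},\rho^{k+1}_{i+1,j})[u^{k+1}_{i+1/2,j}]^++M(\rho^{k+1}_{i+1,j},\rho^{k+1}_{i,j})[u^{k+1}_{i+1/2,j}]^-,$$ $$F^{k+1}_{i,j+1/2}:=M(\rho^{k+1}_{i,j},\rho^{k+1}_{i,j+1})[u^{k+1}_{i,j+1/2}]^++M(\rho^{k+1}_{i,j+1},\rho^{k+1}_{i,j})[u^{k+1}_{i,j+1/2}]^-.$$ All these quantities are extended $N$-periodically in the indices. *)

theory Defs
  imports "HOL-Analysis.Analysis"
begin

definition periodic_grid :: "nat \<Rightarrow> (int \<Rightarrow> int \<Rightarrow> real) \<Rightarrow> bool" where
  "periodic_grid N \<phi> \<longleftrightarrow>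
     (\<forall>i j. \<phi> (i + int N) j = \<phi> i j \<and> \<phi> (i - int N) j = \<phi> i j \<and>
            \<phi> i (j + int N) = \<phi> i j \<and> \<phi> i (j - int N) = \<phi> i j)"

definition symmetric_kernel :: "nat \<Rightarrow> (int \<Rightarrow> int \<Rightarrow> real) \<Rightarrow> bool" where
  "symmetric_kernel N J \<longleftrightarrow>
     periodic_grid N J \<and>
     (\<forall>n m. J n m \<ge> 0 \<and> J n m = J (- n) m \<and> J n m = J n (- m) \<and> J n m = J m n)"

definition discrete_conv ::
  "nat \<Rightarrow> real \<Rightarrow> (int \<Rightarrow> int \<Rightarrow> real) \<Rightarrow> (int \<Rightarrow> int \<Rightarrow> real) \<Rightarrow> int \<Rightarrow> int \<Rightarrow> real" where
  "discrete_conv N h J \<phi> i j =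
     h\<^sup>2 * (\<Sum>n = 0..int N - 1. \<Sum>m = 0..int N - 1. J n m * \<phi> (i - n) (j - m))"

text \<open>The negative part \<open>min a 0\<close> is nonpositive, so that \<open>a\<close> is the sum of its two parts.\<close>

definition pos_part :: "real \<Rightarrow> real" where
  "pos_part a = max a 0"

definition neg_part :: "real \<Rightarrow> real" where
  "neg_part a = min a 0"

definition mobility :: "real \<Rightarrow> real \<Rightarrow> real \<Rightarrow> real" where
  "mobility \<beta> x y = \<beta> * pos_part (1 + x) * pos_part (1 - y)"

text \<open>
  Below, \<open>\<rho>\<close> is the grid function at the old time level \<open>k\<close> and \<open>\<rho>'\<close> the one at the new time
  level \<open>k + 1\<close>. The potential enters only through \<open>deriv fc\<close> and \<open>deriv fe\<close> at points of the open
  interval \<open>I\<close>, hence only through the restrictions of \<open>fc\<close> and \<open>fe\<close> to \<open>I\<close>.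
\<close>

definition chem_potential ::
  "nat \<Rightarrow> real \<Rightarrow> (int \<Rightarrow> int \<Rightarrow> real) \<Rightarrow> (real \<Rightarrow> real) \<Rightarrow> (real \<Rightarrow> real) \<Rightarrow>
   (int \<Rightarrow> int \<Rightarrow> real) \<Rightarrow> (int \<Rightarrow> int \<Rightarrow> real) \<Rightarrow> int \<Rightarrow> int \<Rightarrow> real" where
  "chem_potential N h J fc fe \<rho> \<rho>' i j =
     deriv fc (\<rho>' i j) - deriv fe (\<rho> i j) + 2 * \<rho>' i j - 2 * discrete_conv N h J \<rho> i j"

text \<open>
  Half-integer indices are shifted down: the values at \<open>(i, j)\<close> of the functions with suffix \<open>_x\<close>
  live on the edge \<open>(i + 1/2, j)\<close>, those with suffix \<open>_y\<close> on the edge \<open>(i, j + 1/2)\<close>. In particular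
  the flux through the edge \<open>(i - 1/2, j)\<close> is the value of \<open>flux_x\<close> at \<open>(i - 1, j)\<close>.
\<close>

definition velocity_x :: "real \<Rightarrow> (int \<Rightarrow> int \<Rightarrow> real) \<Rightarrow> int \<Rightarrow> int \<Rightarrow> real" where
  "velocity_x h w i j = - (1 / h) * (w (i + 1) j - w i j)"

definition velocity_y :: "real \<Rightarrow> (int \<Rightarrow> int \<Rightarrow> real) \<Rightarrow> int \<Rightarrow> int \<Rightarrow> real" where
  "velocity_y h w i j = - (1 / h) * (w i (j + 1) - w i j)"

definition flux_x ::
  "nat \<Rightarrow> real \<Rightarrow> real \<Rightarrow> (int \<Rightarrow> int \<Rightarrow> real) \<Rightarrow> (real \<Rightarrow> real) \<Rightarrow> (real \<Rightarrow> real) \<Rightarrow>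
   (int \<Rightarrow> int \<Rightarrow> real) \<Rightarrow> (int \<Rightarrow> int \<Rightarrow> real) \<Rightarrow> int \<Rightarrow> int \<Rightarrow> real" where
  "flux_x N h \<beta> J fc fe \<rho> \<rho>' i j =
     (let u = velocity_x h (chem_potential N h J fc fe \<rho> \<rho>') i j
      in mobility \<beta> (\<rho>' i j) (\<rho>' (i + 1) j) * pos_part u +
         mobility \<beta> (\<rho>' (i + 1) j) (\<rho>' i j) * neg_part u)"

definition flux_y ::
  "nat \<Rightarrow> real \<Rightarrow> real \<Rightarrow> (int \<Rightarrow> int \<Rightarrow> real) \<Rightarrow> (real \<Rightarrow> real) \<Rightarrow> (real \<Rightarrow> real) \<Rightarrow>
   (int \<Rightarrow> int \<Rightarrow> real) \<Rightarrow> (int \<Rightarrow> int \<Rightarrow> real) \<Rightarrow> int \<Rightarrow> int \<Rightarrow> real" where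
  "flux_y N h \<beta> J fc fe \<rho> \<rho>' i j =
     (let u = velocity_y h (chem_potential N h J fc fe \<rho> \<rho>') i j
      in mobility \<beta> (\<rho>' i j) (\<rho>' i (j + 1)) * pos_part u +
         mobility \<beta> (\<rho>' i (j + 1)) (\<rho>' i j) * neg_part u)"

definition scheme_step ::
  "nat \<Rightarrow> real \<Rightarrow> real \<Rightarrow> real \<Rightarrow> (int \<Rightarrow> int \<Rightarrow> real) \<Rightarrow> (real \<Rightarrow> real) \<Rightarrow> (real \<Rightarrow> real) \<Rightarrow>
   (int \<Rightarrow> int \<Rightarrow> real) \<Rightarrow> (int \<Rightarrow> int \<Rightarrow> real) \<Rightarrow> bool" where
  "scheme_step N h \<Delta>t \<beta> J fc fe \<rho> \<rho>' \<longleftrightarrow>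
     (\<forall>i j. (\<rho>' i j - \<rho> i j) / \<Delta>t +
        1 / h * (flux_x N h \<beta> J fc fe \<rho> \<rho>' i j - flux_x N h \<beta> J fc fe \<rho> \<rho>' (i - 1) j +
                 flux_y N h \<beta> J fc fe \<rho> \<rho>' i j - flux_y N h \<beta> J fc fe \<rho> \<rho>' i (j - 1)) = 0)"

end

theory Submission
  imports Defs
begin

text \<open>
  The upwind flux is conservative, so by periodicity the flux differences telescope to zero over the
  whole grid. Boundedness is even pointwise: if the new value in a cell leaves \<open>[-1, 1]\<close>,
  the degenerate mobility shuts off all outflow from that cell (below \<open>-1\<close>) or all inflow into
  it (above \<open>1\<close>). The scheme then forces the new value to lie on the admissible side of the
  old one, a contradiction.
\<close>

lemma mobility_nonneg: "\<beta> \<ge> 0 \<Longrightarrow> mobility \<beta> x y \<ge> 0"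
  by (simp add: mobility_def pos_part_def)

lemma mobility_eq_0_left: "x \<le> -1 \<Longrightarrow> mobility \<beta> x y = 0"
  by (simp add: mobility_def pos_part_def)

lemma mobility_eq_0_right: "y \<ge> 1 \<Longrightarrow> mobility \<beta> x y = 0"
  by (simp add: mobility_def pos_part_def)

text \<open>Common shape of both edge fluxes, with the velocity as a free argument: the sign lemmas
  then hold whatever the chemical potential is.\<close>

definition upwind :: "real \<Rightarrow> real \<Rightarrow> real \<Rightarrow> real \<Rightarrow> real" where
  "upwind \<beta> a b u = mobility \<beta> a b * pos_part u + mobility \<beta> b a * neg_part u"

lemma flux_x_eq_upwind:
  "flux_x N h \<beta> J fc fe \<rho> \<rho>' i j =
     upwind \<beta> (\<rho>' i j) (\<rho>' (i + 1) j) (velocity_x h (chem_potential N h J fc fe \<rho> \<rho>') i j)"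
  by (simp add: flux_x_def upwind_def Let_def)

lemma flux_y_eq_upwind:
  "flux_y N h \<beta> J fc fe \<rho> \<rho>' i j =
     upwind \<beta> (\<rho>' i j) (\<rho>' i (j + 1)) (velocity_y h (chem_potential N h J fc fe \<rho> \<rho>') i j)"
  by (simp add: flux_y_def upwind_def Let_def)

text \<open>Either alternative annihilates \<open>mobility \<beta> b a\<close>, the coefficient of
  \<open>neg_part u\<close>, and what survives is a product of nonnegative factors. The disjunction
  covers a saturated cell on the \<open>a\<close> side and an empty one on the \<open>b\<close>
  side.\<close>

lemma upwind_nonneg:
  assumes "\<beta> \<ge> 0" and "a \<ge> 1 \<or> b \<le> -1"
  shows "upwind \<beta> a b u \<ge> 0"
proof -
  have "mobility \<beta> b a = 0"
    using assms(2) mobility_eq_0_left mobility_eq_0_right by blast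
  then show ?thesis
    using mobility_nonneg[OF assms(1), of a b] by (simp add: upwind_def pos_part_def)
qed

lemma upwind_nonpos:
  assumes "\<beta> \<ge> 0" and "a \<le> -1 \<or> b \<ge> 1"
  shows "upwind \<beta> a b u \<le> 0"
proof -
  have "mobility \<beta> a b = 0"
    using assms(2) mobility_eq_0_left mobility_eq_0_right by blast
  then show ?thesis
    using mobility_nonneg[OF assms(1), of b a]
    by (simp add: upwind_def neg_part_def mult_nonneg_nonpos)
qed

lemma periodic_gridD:
  assumes "periodic_grid N \<phi>"
  shows "\<phi> (i + int N) j = \<phi> i j" and "\<phi> i (j + int N) = \<phi> i j"
  using assms by (simp_all add: periodic_grid_def)

text \<open>The backward shifts come from the forward ones, applied at the index already moved back
  by \<open>N\<close>.\<close>

lemma periodic_gridI: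
  assumes "\<And>i j. \<phi> (i + int N) j = \<phi> i j" and "\<And>i j. \<phi> i (j + int N) = \<phi> i j"
  shows "periodic_grid N \<phi>"
  unfolding periodic_grid_def by (metis assms diff_add_cancel)

lemma periodic_grid_shift:
  assumes "periodic_grid N \<phi>"
  shows "periodic_grid N (\<lambda>i j. \<phi> (i + a) (j + b))"
  by (rule periodic_gridI)
     (metis add.assoc add.commute periodic_gridD(1)[OF assms],
      metis add.assoc add.commute periodic_gridD(2)[OF assms])

lemma periodic_grid_discrete_conv:
  assumes "periodic_grid N \<phi>"
  shows "periodic_grid N (discrete_conv N h J \<phi>)"
proof (rule periodic_gridI)
  fix i j
  show "discrete_conv N h J \<phi> (i + int N) j = discrete_conv N h J \<phi> i j"
    \<comment> \<open>Shifting by \<open>- n\<close> and \<open>- m\<close> gives periodicity in the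
      form in which the summands \<open>\<phi> (i - n) (j - m)\<close> of the convolution meet
      it.\<close>
    using periodic_gridD(1)[OF periodic_grid_shift[OF assms, of "- n" "- m" for n m]]
    by (simp add: discrete_conv_def)
  show "discrete_conv N h J \<phi> i (j + int N) = discrete_conv N h J \<phi> i j"
    using periodic_gridD(2)[OF periodic_grid_shift[OF assms, of "- n" "- m" for n m]]
    by (simp add: discrete_conv_def)
qed

lemma periodic_grid_chem_potential:
  assumes "periodic_grid N \<rho>" and "periodic_grid N \<rho>'"
  shows "periodic_grid N (chem_potential N h J fc fe \<rho> \<rho>')"
  by (rule periodic_gridI)
     (simp_all add: chem_potential_def periodic_gridD[OF assms(1)] periodic_gridD[OF assms(2)]
       periodic_gridD[OF periodic_grid_discrete_conv[OF assms(1)]])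

lemma periodic_grid_flux:
  assumes "periodic_grid N \<rho>" and "periodic_grid N \<rho>'"
  shows "periodic_grid N (flux_x N h \<beta> J fc fe \<rho> \<rho>')"
    and "periodic_grid N (flux_y N h \<beta> J fc fe \<rho> \<rho>')"
proof -
  note w = periodic_grid_chem_potential[OF assms, of h J fc fe]
  note D = periodic_gridD[OF assms(2)] periodic_gridD[OF w]
    \<comment> \<open>An edge sees two cells, so periodicity is also required at the right and upper
      neighbours.\<close>
    periodic_gridD[OF periodic_grid_shift[OF assms(2), of 1 0], simplified]
    periodic_gridD[OF periodic_grid_shift[OF assms(2), of 0 1], simplified]
    periodic_gridD[OF periodic_grid_shift[OF w, of 1 0], simplified]
    periodic_gridD[OF periodic_grid_shift[OF w, of 0 1], simplified]
  show "periodic_grid N (flux_x N h \<beta> J fc fe \<rho> \<rho>')"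
    by (rule periodic_gridI) (simp_all add: flux_x_def velocity_x_def Let_def D)
  show "periodic_grid N (flux_y N h \<beta> J fc fe \<rho> \<rho>')"
    by (rule periodic_gridI) (simp_all add: flux_y_def velocity_y_def Let_def D)
qed

lemma sum_int_telescope:
  fixes g :: "int \<Rightarrow> 'a::ab_group_add"
  shows "(\<Sum>i = 0..int n - 1. g i - g (i - 1)) = g (int n - 1) - g (- 1)"
proof (induction n)
  case 0
  then show ?case by simp
next
  case (Suc n)
  have "{0..int (Suc n) - 1} = insert (int n) {0..int n - 1}" by auto
  with Suc show ?case by simp
qed

text \<open>Wrap-around: the last edge, at \<open>int n - 1\<close>, is identified with the edge at
  \<open>- 1\<close>, the left boundary of cell 0.\<close>

lemma sum_periodic_telescope:
  fixes g :: "int \<Rightarrow> 'a::ab_group_add"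
  assumes "\<And>i. g (i + int n) = g i"
  shows "(\<Sum>i = 0..int n - 1. g i - g (i - 1)) = 0"
  using assms[of "- 1"] by (simp add: sum_int_telescope)

text \<open>An implicit identity, since the fluxes contain \<open>\<rho>'\<close>. The horizontal
  and vertical differences are grouped so that each group telescopes on its own.\<close>

lemma scheme_step_update:
  assumes "scheme_step N h \<Delta>t \<beta> J fc fe \<rho> \<rho>'" and "\<Delta>t > 0"
  shows "\<rho>' i j = \<rho> i j - \<Delta>t / h *
    ((flux_x N h \<beta> J fc fe \<rho> \<rho>' i j - flux_x N h \<beta> J fc fe \<rho> \<rho>' (i - 1) j) +
     (flux_y N h \<beta> J fc fe \<rho> \<rho>' i j - flux_y N h \<beta> J fc fe \<rho> \<rho>' i (j - 1)))"
    (is "_ = _ - _ * ?D")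
proof -
  have "(\<rho>' i j - \<rho> i j) / \<Delta>t + 1 / h * ?D = 0"
    using assms(1) by (simp add: scheme_step_def algebra_simps)
  then have "(\<rho>' i j - \<rho> i j) / \<Delta>t = - (1 / h * ?D)" by linarith
  then have "\<rho>' i j - \<rho> i j = - (1 / h * ?D) * \<Delta>t"
    using assms(2) by (metis less_irrefl nonzero_divide_eq_eq)
  then show ?thesis by (simp add: algebra_simps)
qed

lemma scheme_step_mass:
  assumes "scheme_step N h \<Delta>t \<beta> J fc fe \<rho> \<rho>'" and "\<Delta>t > 0"
    and "periodic_grid N \<rho>" and "periodic_grid N \<rho>'"
  shows "(\<Sum>i = 0..int N - 1. \<Sum>j = 0..int N - 1. \<rho>' i j) =
         (\<Sum>i = 0..int N - 1. \<Sum>j = 0..int N - 1. \<rho> i j)"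
proof -
  let ?F = "flux_x N h \<beta> J fc fe \<rho> \<rho>'" and ?G = "flux_y N h \<beta> J fc fe \<rho> \<rho>'"
  let ?R = "{0..int N - 1}"
  note per = periodic_gridD[OF periodic_grid_flux(1)[OF assms(3,4)]]
    periodic_gridD[OF periodic_grid_flux(2)[OF assms(3,4)]]
  \<comment> \<open>Horizontal differences telescope in \<open>i\<close>, which therefore has to
    become the inner summation index.\<close>
  have "(\<Sum>i\<in>?R. \<Sum>j\<in>?R. ?F i j - ?F (i - 1) j) = (\<Sum>j\<in>?R. \<Sum>i\<in>?R. ?F i j - ?F (i - 1) j)"
    by (rule sum.swap)
  also have "\<dots> = 0"
    by (rule sum.neutral) (use per in \<open>auto intro: sum_periodic_telescope\<close>)
  finally have F: "(\<Sum>i\<in>?R. \<Sum>j\<in>?R. ?F i j - ?F (i - 1) j) = 0" .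
  have G: "(\<Sum>i\<in>?R. \<Sum>j\<in>?R. ?G i j - ?G i (j - 1)) = 0"
    by (rule sum.neutral) (use per in \<open>auto intro: sum_periodic_telescope\<close>)
  have "(\<Sum>i\<in>?R. \<Sum>j\<in>?R. \<rho>' i j) = (\<Sum>i\<in>?R. \<Sum>j\<in>?R. \<rho> i j) - \<Delta>t / h *
      ((\<Sum>i\<in>?R. \<Sum>j\<in>?R. ?F i j - ?F (i - 1) j) + (\<Sum>i\<in>?R. \<Sum>j\<in>?R. ?G i j - ?G i (j - 1)))"
    by (subst scheme_step_update[OF assms(1,2)])
       (simp only: sum_subtractf sum.distrib sum_distrib_left[symmetric])
  then show ?thesis unfolding F G by simp
qed

text \<open>The bound holds for every positive \<open>\<Delta>t\<close> because the mobility is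
  evaluated at the new level: the escaping value itself fixes the signs of the four fluxes.\<close>

lemma scheme_step_lower_bound:
  assumes "scheme_step N h \<Delta>t \<beta> J fc fe \<rho> \<rho>'" and "\<Delta>t > 0" and "h > 0" and "\<beta> \<ge> 0"
    and "\<rho> i j \<ge> -1"
  shows "\<rho>' i j \<ge> -1"
proof (rule ccontr)
  assume "\<not> ?thesis"
  \<comment> \<open>The mobility already vanishes at -1, so the weak inequality suffices for the
    signs; the strict one is kept for the contradiction.\<close>
  then have le: "\<rho>' i j \<le> -1" by simp
  let ?F = "flux_x N h \<beta> J fc fe \<rho> \<rho>'" and ?G = "flux_y N h \<beta> J fc fe \<rho> \<rho>'"
  \<comment> \<open>The cell is argument \<open>a\<close> of \<open>upwind\<close> on its right and
    upper edges, and argument \<open>b\<close> on its left and lower edges, which are stored at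
    \<open>i - 1\<close> and \<open>j - 1\<close>.\<close>
  have "?F i j \<le> 0" "?G i j \<le> 0" "?F (i - 1) j \<ge> 0" "?G i (j - 1) \<ge> 0"
    using le assms(4)
    by (auto simp: flux_x_eq_upwind flux_y_eq_upwind intro!: upwind_nonneg upwind_nonpos)
  then have "\<Delta>t / h * ((?F i j - ?F (i - 1) j) + (?G i j - ?G i (j - 1))) \<le> 0"
    using assms(2,3) by (intro mult_nonneg_nonpos) auto
  with scheme_step_update[OF assms(1,2), of i j] assms(5) \<open>\<not> ?thesis\<close> show False
    by linarith
qed

lemma scheme_step_upper_bound:
  assumes "scheme_step N h \<Delta>t \<beta> J fc fe \<rho> \<rho>'" and "\<Delta>t > 0" and "h > 0" and "\<beta> \<ge> 0"
    and "\<rho> i j \<le> 1"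
  shows "\<rho>' i j \<le> 1"
proof (rule ccontr)
  assume "\<not> ?thesis"
  then have ge: "\<rho>' i j \<ge> 1" by simp
  let ?F = "flux_x N h \<beta> J fc fe \<rho> \<rho>'" and ?G = "flux_y N h \<beta> J fc fe \<rho> \<rho>'"
  \<comment> \<open>All four signs are reversed: a cell at or above 1 can only lose mass, so its new
    value cannot exceed the old one.\<close>
  have "?F i j \<ge> 0" "?G i j \<ge> 0" "?F (i - 1) j \<le> 0" "?G i (j - 1) \<le> 0"
    using ge assms(4)
    by (auto simp: flux_x_eq_upwind flux_y_eq_upwind intro!: upwind_nonneg upwind_nonpos)
  then have "\<Delta>t / h * ((?F i j - ?F (i - 1) j) + (?G i j - ?G i (j - 1))) \<ge> 0"
    using assms(2,3) by (intro mult_nonneg_nonneg) auto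
  with scheme_step_update[OF assms(1,2), of i j] assms(5) \<open>\<not> ?thesis\<close> show False
    by linarith
qed

theorem theorem3p1:
  fixes N :: nat and h \<Delta>t \<beta> :: real
    and I :: "real set" and f fc fe :: "real \<Rightarrow> real"
    and J \<rho> \<rho>' :: "int \<Rightarrow> int \<Rightarrow> real"
  assumes "N \<ge> 1" and "h > 0" and "\<Delta>t > 0" and "\<beta> > 0"
    and "open I" and "is_interval I"
    and "convex_on I fc" and "fc differentiable_on I"
    and "convex_on I fe" and "fe differentiable_on I"
    and "\<And>x. x \<in> I \<Longrightarrow> f x = fc x - fe x"
    and "symmetric_kernel N J"
    and "periodic_grid N \<rho>" and "\<And>i j. \<rho> i j \<in> I"
    and "periodic_grid N \<rho>'" and "\<And>i j. \<rho>' i j \<in> I"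
    and "scheme_step N h \<Delta>t \<beta> J fc fe \<rho> \<rho>'"
  shows "(\<Sum>i = 0..int N - 1. \<Sum>j = 0..int N - 1. \<rho>' i j) =
           (\<Sum>i = 0..int N - 1. \<Sum>j = 0..int N - 1. \<rho> i j) \<and>
         ((\<forall>i j. \<bar>\<rho> i j\<bar> \<le> 1) \<longrightarrow> (\<forall>i j. \<bar>\<rho>' i j\<bar> \<le> 1))"
proof (intro conjI impI allI)
  note step = \<open>scheme_step N h \<Delta>t \<beta> J fc fe \<rho> \<rho>'\<close>
  show "(\<Sum>i = 0..int N - 1. \<Sum>j = 0..int N - 1. \<rho>' i j) =
        (\<Sum>i = 0..int N - 1. \<Sum>j = 0..int N - 1. \<rho> i j)"
    using step \<open>\<Delta>t > 0\<close> \<open>periodic_grid N \<rho>\<close> \<open>periodic_grid N \<rho>'\<close> by (rule scheme_step_mass)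
  fix i j
  assume "\<forall>i j. \<bar>\<rho> i j\<bar> \<le> 1"
  then have "-1 \<le> \<rho> i j" "\<rho> i j \<le> 1"
    by (simp_all add: abs_le_iff minus_le_iff)
  then have "-1 \<le> \<rho>' i j" "\<rho>' i j \<le> 1"
    using scheme_step_lower_bound[OF step] scheme_step_upper_bound[OF step]
      \<open>\<Delta>t > 0\<close> \<open>h > 0\<close> \<open>\<beta> > 0\<close> by simp_all
  then show "\<bar>\<rho>' i j\<bar> \<le> 1" by simp
qed

end
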